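(* Let $\Omega\subset\mathbb{C}$ be a simply-connected domain. Suppose $T : \Omega \to \mathbb{C}^{n \times n}$ and $E : \Omega \to \mathbb{C}^{n \times n}$ are analytic, with $T$ regular, let $\epsilon>0$, and let $$\Omega_{\epsilon} = \{ z \in \Omega : \|E(z)\| < \epsilon \}.$$ Then $$\Lambda(T+E) \cap \Omega_{\epsilon} \subset \Lambda_{\epsilon}(T) \cap \Omega_{\epsilon}.$$ Furthermore, if $\mathcal{U}$ is a bounded connected component of $\Lambda_{\epsilon}(T)$ such that $\overline{\mathcal{U}} \subset \Omega_{\epsilon}$, then $\mathcal{U}$ contains exactly the same number of eigenvalues of $T$ and of $T+E$, counting multiplicity.
   Context: An analytic $F:\Omega\to\mathbb{C}^{n\times n}$ is regular if $\det F(z)\not\equiv 0$ on $\Omega$. A point $\lambda\in\Omega$ is an eigenvalue of $F$ if $F(\lambda)$ is singular; its multiplicity is the order of the zero of $\det F(z)$ at $\lambda$. The spectrum $\Lambda(F)$ is the set of $\lambda\in\Omega$ with $F(\lambda)$ singular. Eigenvalues in a region are counted with multiplicity. $\|\cdot\|$ denotes a matrix norm on $\mathbb{C}^{n\times n}$ induced by a vector norm on $\mathbb{C}^n$. The $\epsilon$-pseudospectrum of $T$ is $\Lambda_\epsilon(T)=\{z\in\Omega : \|T(z)^{-1}\|>\epsilon^{-1}\}$, with the convention $\|T(z)^{-1}\|=\infty$ when $T(z)$ is singular; equivalently, it is the union of $\Lambda(T+F)$ over all analytic $F:\Omega\to\mathbb{C}^{n\times n}$ with $\sup_{z\in\Omega}\|F(z)\|<\epsilon$.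 *)

theory Defs
  imports "HOL-Complex_Analysis.Complex_Analysis"
begin

definition vec_norm :: "(complex^'n \<Rightarrow> real) \<Rightarrow> bool" where
  "vec_norm N \<longleftrightarrow>
     (\<forall>x. 0 \<le> N x) \<and>
     (\<forall>x. N x = 0 \<longleftrightarrow> x = 0) \<and>
     (\<forall>c x. N (c *s x) = cmod c * N x) \<and>
     (\<forall>x y. N (x + y) \<le> N x + N y)"

text \<open>
  If \<open>N\<close> is a norm, the set below is nonempty and, the space being finite-dimensional,
  bounded above, so the real-valued supremum is the true one.
\<close>

definition induced_norm :: "(complex^'n \<Rightarrow> real) \<Rightarrow> complex^'n^'n \<Rightarrow> real" where
  "induced_norm N A = (SUP x\<in>{x. N x = 1}. N (A *v x))"

text \<open>The norm of the inverse, with the convention that it is infinite for singular matrices.\<close>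

definition inverse_norm :: "(complex^'n \<Rightarrow> real) \<Rightarrow> complex^'n^'n \<Rightarrow> ereal" where
  "inverse_norm N A = (if invertible A then ereal (induced_norm N (matrix_inv A)) else \<infinity>)"

definition mat_analytic_on :: "(complex \<Rightarrow> complex^'n^'n) \<Rightarrow> complex set \<Rightarrow> bool" where
  "mat_analytic_on F \<Omega> \<longleftrightarrow> (\<forall>i j. (\<lambda>z. F z $ i $ j) analytic_on \<Omega>)"

definition regular_on :: "(complex \<Rightarrow> complex^'n^'n) \<Rightarrow> complex set \<Rightarrow> bool" where
  "regular_on F \<Omega> \<longleftrightarrow> (\<exists>z\<in>\<Omega>. det (F z) \<noteq> 0)"

definition eigenvalues :: "complex set \<Rightarrow> (complex \<Rightarrow> complex^'n^'n) \<Rightarrow> complex set" where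
  "eigenvalues \<Omega> F = {z \<in> \<Omega>. \<not> invertible (F z)}"

definition pseudospectrum ::
    "(complex^'n \<Rightarrow> real) \<Rightarrow> complex set \<Rightarrow> real \<Rightarrow> (complex \<Rightarrow> complex^'n^'n) \<Rightarrow> complex set" where
  "pseudospectrum N \<Omega> \<epsilon> F = {z \<in> \<Omega>. inverse_norm N (F z) > ereal (inverse \<epsilon>)}"

text \<open>
  \<^const>\<open>zorder\<close> is the order of the zero only if the determinant does not vanish identically
  near the point.
\<close>

definition eig_multiplicity :: "(complex \<Rightarrow> complex^'n^'n) \<Rightarrow> complex \<Rightarrow> int" where
  "eig_multiplicity F z = zorder (\<lambda>w. det (F w)) z"

text \<open>Meaningful only if there are finitely many eigenvalues in \<open>U\<close>: infinite sums are 0.\<close>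

definition eig_count :: "complex set \<Rightarrow> (complex \<Rightarrow> complex^'n^'n) \<Rightarrow> complex set \<Rightarrow> int" where
  "eig_count \<Omega> F U = (\<Sum>z\<in>eigenvalues \<Omega> F \<inter> U. eig_multiplicity F z)"

end

theory Submission
  imports Defs
begin

text \<open>
  The matrix enters only through one reformulation: \<open>\<parallel>A\<inverse>\<parallel> > 1/\<epsilon>\<close>, singular matrices included, holds
  exactly if some \<open>x\<close> has \<open>\<parallel>A x\<parallel> < \<epsilon> \<parallel>x\<parallel>\<close> (\<open>inverse_norm_greater_iff\<close>). If \<open>(A + t B) x = 0\<close> with
  \<open>0 \<le> t \<le> 1\<close>, \<open>x \<noteq> 0\<close> and \<open>\<parallel>B\<parallel> < \<epsilon>\<close>, then \<open>\<parallel>A x\<parallel> = t \<parallel>B x\<parallel> < \<epsilon> \<parallel>x\<parallel>\<close>. So where \<open>\<parallel>E\<parallel> < \<epsilon>\<close>, all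
  the matrices \<open>T + t E\<close> are invertible outside the pseudospectrum (\<open>perturbation_invertible\<close>);
  for \<open>t = 1\<close> this is the inclusion of the spectrum of \<open>T + E\<close>.

  The reformulation also writes the pseudospectrum as a union of open sets, one for each \<open>x\<close>.
  Being open, it misses its own frontier, and the frontier of a component \<open>U\<close> lies in that frontier.
  Hence the functions \<open>h\<^sub>t = det (T + t E)\<close>, \<open>0 \<le> t \<le> 1\<close>, have no zero on the frontier of \<open>U\<close>,
  and it remains to see that the number of zeros in \<open>U\<close> does not change along this homotopy
  (\<open>zero_count_homotopy\<close>).

  The frontier of \<open>U\<close> need not contain a curve that goes around \<open>U\<close>, so the argument principle is
  not applied to \<open>U\<close> itself. Instead the count is shown to be locally constant in \<open>t\<close>
  (\<open>zero_count_stable\<close>): the finitely many zeros of \<open>h\<^sub>t\<close> in \<open>U\<close> are enclosed in small disjoint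
  discs. On the compact rest of the closure of \<open>U\<close>, the modulus of \<open>h\<^sub>t\<close> has a positive minimum, so
  a nearby function has no zeros there, and on each disc Rouche's theorem for circles compares the
  two. Since the interval from \<open>0\<close> to \<open>1\<close> is connected, the count is constant. It is finite because
  the bounded nonempty set \<open>U\<close> has a frontier point, at which \<open>h\<^sub>t\<close> is not zero, so that
  \<open>h\<^sub>t\<close> does not vanish identically on the domain.
\<close>

section \<open>Norms on complex vectors and their induced matrix norms\<close>

lemma vec_norm_zero: "vec_norm N \<Longrightarrow> N 0 = 0"
  by (simp add: vec_norm_def)

lemma vec_norm_pos: "vec_norm N \<Longrightarrow> x \<noteq> 0 \<Longrightarrow> 0 < N x"
  unfolding vec_norm_def by (metis less_eq_real_def)

lemma vec_norm_scaleR: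
  assumes "vec_norm N"
  shows "N (c *\<^sub>R x) = \<bar>c\<bar> * N x"
proof -
  have "c *\<^sub>R x = complex_of_real c *s x"
    by (simp add: vec_eq_iff) (simp add: scaleR_conv_of_real)
  then show ?thesis
    using assms by (simp add: vec_norm_def)
qed

text \<open>
  A norm is convex, and convex functions on a finite-dimensional space are continuous.
\<close>

lemma vec_norm_continuous:
  fixes N :: "complex^'n \<Rightarrow> real"
  assumes "vec_norm N"
  shows "continuous_on UNIV N"
proof (rule convex_on_continuous)
  show "convex_on UNIV N"
  proof (rule convex_onI)
    fix t :: real and x y :: "complex^'n"
    assume t: "0 < t" "t < 1"
    have "N ((1 - t) *\<^sub>R x + t *\<^sub>R y) \<le> N ((1 - t) *\<^sub>R x) + N (t *\<^sub>R y)"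
      using assms by (simp add: vec_norm_def)
    with t show "N ((1 - t) *\<^sub>R x + t *\<^sub>R y) \<le> (1 - t) * N x + t * N y"
      by (simp add: vec_norm_scaleR[OF assms])
  qed simp
qed simp

text \<open>
  The minimum of \<open>N\<close> on the Euclidean unit sphere bounds \<open>N\<close> from below by a multiple of the
  Euclidean norm, so the unit sphere of \<open>N\<close> is bounded. Its compactness makes the supremum that
  defines the induced norm finite.
\<close>

lemma compact_vec_norm_sphere:
  fixes N :: "complex^'n \<Rightarrow> real"
  assumes "vec_norm N"
  shows "compact {x. N x = 1}"
proof -
  have cont: "continuous_on S N" for S
    using vec_norm_continuous[OF assms] continuous_on_subset by blast
  have "axis undefined 1 \<in> sphere (0 :: complex^'n) 1"
    by (simp add: norm_axis_1)
  then have "sphere (0 :: complex^'n) 1 \<noteq> {}"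
    by blast
  then obtain u :: "complex^'n" where u: "norm u = 1" and min: "\<And>x. norm x = 1 \<Longrightarrow> N u \<le> N x"
    using continuous_attains_inf[OF compact_sphere _ cont[of "sphere 0 1"]] by auto
  have "N u > 0"
    using u by (intro vec_norm_pos[OF assms]) auto
  have lower: "N u * norm x \<le> N x" for x
  proof (cases "x = 0")
    case False
    then have "N u \<le> N ((1 / norm x) *\<^sub>R x)"
      by (intro min) simp
    also have "\<dots> = N x / norm x"
      by (simp add: vec_norm_scaleR[OF assms])
    finally show ?thesis
      using False by (simp add: field_simps)
  qed (simp add: vec_norm_zero[OF assms])
  have "norm x \<le> 1 / N u" if "N x = 1" for x
    using lower[of x] that \<open>N u > 0\<close> by (simp add: field_simps)
  then have "bounded {x. N x = 1}"
    unfolding bounded_iff by blast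
  moreover have "closed {x. N x = 1}"
    using vec_norm_continuous[OF assms] by (intro closed_Collect_eq) auto
  ultimately show ?thesis
    by (simp add: compact_eq_bounded_closed)
qed

lemma continuous_on_vec_norm_mult:
  assumes "vec_norm N"
  shows "continuous_on S (\<lambda>x. N ((A :: complex^'n^'n) *v x))"
  by (rule continuous_on_compose2[OF vec_norm_continuous[OF assms]])
    (auto intro: linear_continuous_on matrix_vector_mul_bounded_linear)

lemma bdd_above_induced_norm:
  assumes "vec_norm N"
  shows "bdd_above ((\<lambda>x. N (A *v x)) ` {x. N x = 1})"
  using compact_continuous_image[OF continuous_on_vec_norm_mult[OF assms]
      compact_vec_norm_sphere[OF assms]]
  by (simp add: bounded_imp_bdd_above compact_imp_bounded)

lemma vec_norm_normalize:
  assumes "vec_norm N" "x \<noteq> 0"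
  shows "N (inverse (N x) *\<^sub>R x) = 1"
  using vec_norm_pos[OF assms] by (simp add: vec_norm_scaleR[OF assms(1)])

lemma vec_norm_sphere_nonempty:
  fixes N :: "complex^'n \<Rightarrow> real"
  assumes "vec_norm N"
  shows "{x. N x = 1} \<noteq> {}"
  using vec_norm_normalize[OF assms, of "axis undefined 1"] by (auto simp: axis_eq_0_iff)

lemma matrix_vector_mult_scaleR:
  fixes A :: "complex^'n^'n"
  shows "A *v (c *\<^sub>R x) = c *\<^sub>R (A *v x)" "(c *\<^sub>R A) *v x = c *\<^sub>R (A *v x)"
  by (simp_all add: matrix_vector_mult_def vec_eq_iff scaleR_sum_right)

lemma induced_norm_bound:
  assumes "vec_norm N"
  shows "N (A *v x) \<le> induced_norm N A * N x"
proof (cases "x = 0")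
  case False
  define y where "y = inverse (N x) *\<^sub>R x"
  have "N x > 0"
    using vec_norm_pos[OF assms False] .
  have "N (A *v y) \<le> induced_norm N A"
    unfolding induced_norm_def
    using vec_norm_normalize[OF assms False] bdd_above_induced_norm[OF assms]
    by (intro cSUP_upper) (auto simp: y_def)
  moreover have "N (A *v y) = N (A *v x) / N x"
    using \<open>N x > 0\<close>
    by (simp add: y_def matrix_vector_mult_scaleR vec_norm_scaleR[OF assms] field_simps)
  ultimately show ?thesis
    using \<open>N x > 0\<close> by (simp add: field_simps)
qed (simp add: vec_norm_zero[OF assms])

section \<open>The pseudospectrum\<close>

lemma invertible_iff_kernel:
  fixes A :: "complex^'n^'n"
  shows "invertible A \<longleftrightarrow> (\<forall>x. A *v x = 0 \<longrightarrow> x = 0)"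
  by (simp add: invertible_left_inverse matrix_left_invertible_ker)

text \<open>
  For invertible \<open>A\<close>, substitute \<open>y = A x\<close> in the supremum that defines \<open>\<parallel>A\<inverse>\<parallel>\<close>; for singular \<open>A\<close>, a
  kernel vector is a witness. The right-hand side treats both cases alike.
\<close>

lemma inverse_norm_greater_iff:
  fixes A :: "complex^'n^'n"
  assumes N: "vec_norm N" and "\<epsilon> > 0"
  shows "inverse_norm N A > ereal (inverse \<epsilon>) \<longleftrightarrow> (\<exists>x. N (A *v x) < \<epsilon> * N x)"
proof (cases "invertible A")
  case False
  then obtain x where "A *v x = 0" "x \<noteq> 0"
    by (auto simp: invertible_iff_kernel)
  then have "N (A *v x) < \<epsilon> * N x"
    using \<open>\<epsilon> > 0\<close> by (simp add: vec_norm_zero[OF N] vec_norm_pos[OF N])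
  then show ?thesis
    using False by (auto simp: inverse_norm_def)
next
  case True
  have "A ** matrix_inv A = mat 1 \<and> matrix_inv A ** A = mat 1"
    using True unfolding invertible_def matrix_inv_def by (rule someI_ex)
  then have inv: "A *v (matrix_inv A *v y) = y" "matrix_inv A *v (A *v x) = x" for x y
    by (simp_all add: matrix_vector_mul_assoc)
  have "inverse_norm N A > ereal (inverse \<epsilon>) \<longleftrightarrow> inverse \<epsilon> < induced_norm N (matrix_inv A)"
    using True by (simp add: inverse_norm_def)
  also have "\<dots> \<longleftrightarrow> (\<exists>y\<in>{y. N y = 1}. inverse \<epsilon> < N (matrix_inv A *v y))"
    unfolding induced_norm_def
    by (rule less_cSUP_iff[OF vec_norm_sphere_nonempty[OF N] bdd_above_induced_norm[OF N]])
  also have "\<dots> \<longleftrightarrow> (\<exists>x. N (A *v x) < \<epsilon> * N x)"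
  proof safe
    fix y assume "N y = 1" "inverse \<epsilon> < N (matrix_inv A *v y)"
    then show "\<exists>x. N (A *v x) < \<epsilon> * N x"
      using \<open>\<epsilon> > 0\<close> by (intro exI[of _ "matrix_inv A *v y"]) (simp add: inv field_simps)
  next
    fix x assume x: "N (A *v x) < \<epsilon> * N x"
    define y where "y = A *v x"
    have "y \<noteq> 0"
    proof
      assume "y = 0"
      with True have "x = 0"
        by (simp add: y_def invertible_iff_kernel)
      with x show False
        by (simp add: vec_norm_zero[OF N])
    qed
    then have "N y > 0"
      by (rule vec_norm_pos[OF N])
    have "inverse \<epsilon> < N x / N y"
      using x \<open>\<epsilon> > 0\<close> \<open>N y > 0\<close> by (simp add: y_def field_simps)
    also have "\<dots> = N (matrix_inv A *v (inverse (N y) *\<^sub>R y))"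
      using \<open>N y > 0\<close> inv(2)[of x]
      by (simp add: matrix_vector_mult_scaleR vec_norm_scaleR[OF N] y_def field_simps)
    finally have "inverse \<epsilon> < N (matrix_inv A *v (inverse (N y) *\<^sub>R y))" .
    with vec_norm_normalize[OF N \<open>y \<noteq> 0\<close>]
    show "\<exists>y\<in>{y. N y = 1}. inverse \<epsilon> < N (matrix_inv A *v y)"
      by blast
  qed
  finally show ?thesis .
qed

lemma mat_analytic_on_imp_continuous_on:
  assumes "mat_analytic_on F \<Omega>"
  shows "continuous_on \<Omega> F"
proof -
  have "continuous_on \<Omega> (\<lambda>z. F z $ i $ j)" for i j
    using assms by (simp add: mat_analytic_on_def analytic_imp_holomorphic
        holomorphic_on_imp_continuous_on)
  then have "continuous_on \<Omega> (\<lambda>z. \<chi> i j. F z $ i $ j)"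
    by (intro continuous_on_vec_lambda)
  then show ?thesis
    by simp
qed

text \<open>
  For fixed \<open>x\<close> the condition \<open>\<parallel>T(z) x\<parallel> < \<epsilon> \<parallel>x\<parallel>\<close> is open in \<open>z\<close>, and the pseudospectrum is the union of
  the sets that it defines.
\<close>

lemma open_pseudospectrum:
  fixes T :: "complex \<Rightarrow> complex^'n^'n"
  assumes N: "vec_norm N" and "\<epsilon> > 0" and "open \<Omega>" and T: "mat_analytic_on T \<Omega>"
  shows "open (pseudospectrum N \<Omega> \<epsilon> T)"
proof -
  have "pseudospectrum N \<Omega> \<epsilon> T = (\<Union>x. {z \<in> \<Omega>. N (T z *v x) < \<epsilon> * N x})"
    by (auto simp: pseudospectrum_def inverse_norm_greater_iff[OF N \<open>\<epsilon> > 0\<close>])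
  moreover have "open {z \<in> \<Omega>. N (T z *v x) < \<epsilon> * N x}" for x
  proof -
    have "continuous_on \<Omega> (\<lambda>z. T z *v x)"
      unfolding matrix_vector_mult_def
      by (intro continuous_intros continuous_on_vec_lambda
          mat_analytic_on_imp_continuous_on[OF T])
    then have cont: "continuous_on \<Omega> (\<lambda>z. N (T z *v x))"
      using continuous_on_compose2[OF vec_norm_continuous[OF N]] by blast
    have "{z \<in> \<Omega>. N (T z *v x) < \<epsilon> * N x} = \<Omega> \<inter> (\<lambda>z. N (T z *v x)) -` {..<\<epsilon> * N x}"
      by auto
    then show ?thesis
      using continuous_open_preimage[OF cont \<open>open \<Omega>\<close> open_lessThan] by simp
  qed
  ultimately show ?thesis
    by auto
qed

text \<open>
  A kernel vector \<open>x\<close> of \<open>A + t B\<close> satisfies \<open>\<parallel>A x\<parallel> = t \<parallel>B x\<parallel> < \<epsilon> \<parallel>x\<parallel>\<close>. The parameter \<open>t\<close> provides the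
  whole segment from \<open>A\<close> to \<open>A + B\<close>, along which zeros are followed later.
\<close>

lemma perturbation_invertible:
  fixes A B :: "complex^'n^'n"
  assumes N: "vec_norm N" and "\<epsilon> > 0"
    and A: "inverse_norm N A \<le> ereal (inverse \<epsilon>)" and B: "induced_norm N B < \<epsilon>"
    and t: "0 \<le> t" "t \<le> 1"
  shows "invertible (A + t *\<^sub>R B)"
  unfolding invertible_iff_kernel
proof (intro allI impI, rule ccontr)
  fix x assume x: "(A + t *\<^sub>R B) *v x = 0" "x \<noteq> 0"
  then have "A *v x = (- t) *\<^sub>R (B *v x)"
    by (simp add: matrix_vector_mult_add_rdistrib matrix_vector_mult_scaleR eq_neg_iff_add_eq_0)
  then have "N (A *v x) = t * N (B *v x)"
    using t by (simp only: vec_norm_scaleR[OF N]) simp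
  also have "\<dots> \<le> N (B *v x)"
    using N t by (simp add: vec_norm_def mult_left_le_one_le)
  also have "\<dots> \<le> induced_norm N B * N x"
    by (rule induced_norm_bound[OF N])
  also have "\<dots> < \<epsilon> * N x"
    using B vec_norm_pos[OF N x(2)] by (rule mult_strict_right_mono)
  finally show False
    using A inverse_norm_greater_iff[OF N \<open>\<epsilon> > 0\<close>, of A] by (auto simp: not_less)
qed

section \<open>Counting zeros of holomorphic functions\<close>

text \<open>
  Zeros are counted with their orders, under the conventions of \<^const>\<open>eig_count\<close>: the value is
  meaningful only if the zeros are finite in number and isolated.
\<close>

definition zero_count :: "(complex \<Rightarrow> complex) \<Rightarrow> complex set \<Rightarrow> int" where
  "zero_count f U = (\<Sum>z\<in>{z \<in> U. f z = 0}. zorder f z)"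

lemma finite_zeros_in_compact:
  assumes "f holomorphic_on \<Omega>" "open \<Omega>" "connected \<Omega>" "compact K" "K \<subseteq> \<Omega>"
    and "p \<in> \<Omega>" "f p \<noteq> 0"
  shows "finite {z \<in> K. f z = 0}"
proof (cases "f constant_on \<Omega>")
  case True
  then have "{z \<in> K. f z = 0} = {}"
    using assms(5-7) unfolding constant_on_def by (metis (mono_tags, lifting) empty_Collect_eq subsetD)
  then show ?thesis
    by (simp only: finite.emptyI)
qed (use holomorphic_compact_finite_zeros assms in blast)

text \<open>
  The circle has winding number \<open>1\<close> about the points of the disc and \<open>0\<close> about all points outside, so the
  weighted sums in Rouche's theorem become plain counts. The theorem asks for finitely many zeros
  in the ambient domain, which \<open>\<Omega>\<close> need not provide; it is applied on a slightly larger disc.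
\<close>

lemma Rouche_disc:
  assumes f: "f holomorphic_on \<Omega>" and g: "g holomorphic_on \<Omega>"
    and \<Omega>: "open \<Omega>" "connected \<Omega>"
    and "0 < r" and sub: "cball p r \<subseteq> \<Omega>"
    and less: "\<And>z. z \<in> sphere p r \<Longrightarrow> cmod (g z - f z) < cmod (f z)"
  shows "zero_count g (ball p r) = zero_count f (ball p r)"
proof -
  obtain e where "e > 0" and e: "(\<Union>x\<in>cball p r. cball x e) \<subseteq> \<Omega>"
    using compact_subset_open_imp_cball_epsilon_subset[OF compact_cball \<Omega>(1) sub] .
  define R where "R = r + e"
  have "R > r"
    using \<open>e > 0\<close> by (simp add: R_def)
  have cballR: "cball p R \<subseteq> \<Omega>"
  proof
    fix z assume "z \<in> cball p R"
    show "z \<in> \<Omega>"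
    proof (cases "z \<in> cball p r")
      case False
      define d where "d = dist p z"
      \<comment> \<open>the point where the segment from \<open>p\<close> to \<open>z\<close> leaves the disc\<close>
      define w where "w = p + (r / d) *\<^sub>R (z - p)"
      have d: "r < d" "d \<le> r + e" "0 < d"
        using False \<open>z \<in> cball p R\<close> \<open>0 < r\<close> by (auto simp: d_def R_def)
      have "dist p w = \<bar>r / d\<bar> * d"
        by (simp add: w_def d_def dist_norm norm_minus_commute)
      then have "w \<in> cball p r"
        using d \<open>0 < r\<close> by simp
      have "z - w = (1 - r / d) *\<^sub>R (z - p)"
        by (simp add: w_def algebra_simps)
      then have "dist w z = \<bar>1 - r / d\<bar> * d"
        by (metis d_def dist_commute dist_norm norm_scaleR)
      also have "\<dots> = d - r"
        using d \<open>0 < r\<close> by (simp add: field_simps)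
      finally have "z \<in> cball w e"
        using d by simp
      with e \<open>w \<in> cball p r\<close> show ?thesis
        by blast
    qed (use sub in blast)
  qed
  have mem: "p + of_real r \<in> sphere p r"
    using \<open>0 < r\<close> by (simp add: dist_norm)
  then have "p + of_real r \<in> \<Omega>"
    using sub sphere_cball by blast
  moreover have "f (p + of_real r) \<noteq> 0" "g (p + of_real r) \<noteq> 0"
    using less[OF mem] by auto
  ultimately have "finite {z \<in> cball p R. f z = 0}" "finite {z \<in> cball p R. g z = 0}"
    using finite_zeros_in_compact[OF f \<Omega> compact_cball cballR]
      finite_zeros_in_compact[OF g \<Omega> compact_cball cballR]
    by blast+
  moreover have "{z \<in> ball p R. h z = 0} \<subseteq> {z \<in> cball p R. h z = 0}" for h :: "complex \<Rightarrow> complex"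
    using ball_subset_cball by blast
  ultimately have fin: "finite {z \<in> ball p R. f z = 0}" "finite {z \<in> ball p R. g z = 0}"
    using finite_subset by blast+
  let ?\<gamma> = "circlepath p r"
  have nz: "f z \<noteq> 0" "g z \<noteq> 0" if "z \<in> sphere p r" for z
    using less[OF that] by auto
  have wn: "winding_number ?\<gamma> z = (if z \<in> ball p r then 1 else 0)" if "z \<notin> sphere p r" for z
  proof (cases "z \<in> ball p r")
    case True
    then show ?thesis
      by (simp add: winding_number_circlepath dist_norm norm_minus_commute)
  next
    case False
    with that have "z \<notin> cball p r" by auto
    with False show ?thesis
      using winding_number_zero_outside[of ?\<gamma> "cball p r" z] \<open>0 < r\<close> by auto
  qed
  have count: "(\<Sum>z\<in>{z \<in> ball p R. h z = 0}. winding_number ?\<gamma> z * zorder h z)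
        = of_int (zero_count h (ball p r))"
    if h: "finite {z \<in> ball p R. h z = 0}" and "\<And>z. z \<in> sphere p r \<Longrightarrow> h z \<noteq> 0" for h
  proof -
    have "(\<Sum>z\<in>{z \<in> ball p R. h z = 0}. winding_number ?\<gamma> z * zorder h z)
        = (\<Sum>z\<in>{z \<in> ball p r. h z = 0}. of_int (zorder h z))"
    proof (rule sum.mono_neutral_cong_right)
      show "{z \<in> ball p r. h z = 0} \<subseteq> {z \<in> ball p R. h z = 0}"
        using \<open>R > r\<close> by auto
      show "\<forall>z\<in>{z \<in> ball p R. h z = 0} - {z \<in> ball p r. h z = 0}.
          winding_number ?\<gamma> z * of_int (zorder h z) = 0"
      proof
        fix z assume z: "z \<in> {z \<in> ball p R. h z = 0} - {z \<in> ball p r. h z = 0}"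
        then have "z \<notin> sphere p r" "z \<notin> ball p r"
          using that(2)[of z] by blast+
        then show "winding_number ?\<gamma> z * of_int (zorder h z) = 0"
          using wn[of z] by simp
      qed
    qed (use h wn in auto)
    then show ?thesis
      by (simp add: zero_count_def)
  qed
  have "(\<Sum>z\<in>{z \<in> ball p R. f z + (g z - f z) = 0}.
          winding_number ?\<gamma> z * zorder (\<lambda>z. f z + (g z - f z)) z)
      = (\<Sum>z\<in>{z \<in> ball p R. f z = 0}. winding_number ?\<gamma> z * zorder f z)"
  proof (rule Rouche_theorem)
    have "ball p R \<subseteq> \<Omega>"
      using cballR ball_subset_cball by blast
    then show "f holomorphic_on ball p R" "(\<lambda>z. g z - f z) holomorphic_on ball p R"
      using holomorphic_on_subset[OF f] holomorphic_on_subset[OF g]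
      by (blast intro: holomorphic_on_diff)+
    show "path_image ?\<gamma> \<subseteq> ball p R" "\<forall>z\<in>path_image ?\<gamma>. cmod (g z - f z) < cmod (f z)"
      using \<open>0 < r\<close> \<open>R > r\<close> less by auto
    show "\<forall>z. z \<notin> ball p R \<longrightarrow> winding_number ?\<gamma> z = 0"
      using wn \<open>R > r\<close> by auto
  qed (use fin in auto)
  then have "complex_of_int (zero_count g (ball p r)) = of_int (zero_count f (ball p r))"
    using count[OF fin(1)] count[OF fin(2)] nz by simp
  then show ?thesis
    by simp
qed

text \<open>
  The constant \<open>\<delta>\<close> is the minimum of \<open>|f|\<close> on the closure of \<open>U\<close> without small disjoint open discs
  around the zeros of \<open>f\<close>. This compact set contains both the frontier of \<open>U\<close> and the circles that
  bound the discs. A function closer than \<open>\<delta>\<close> to \<open>f\<close> on the closure therefore has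
  all its zeros there in the discs, and in
  each of them as many as \<open>f\<close>.
\<close>

lemma zero_count_stable:
  assumes f: "f holomorphic_on \<Omega>" and \<Omega>: "open \<Omega>" "connected \<Omega>"
    and U: "open U" "bounded U" "U \<noteq> {}" "closure U \<subseteq> \<Omega>"
    and nz: "\<And>z. z \<in> frontier U \<Longrightarrow> f z \<noteq> 0"
  obtains \<delta> where "\<delta> > 0"
    and "\<And>g. g holomorphic_on \<Omega> \<Longrightarrow> (\<And>z. z \<in> closure U \<Longrightarrow> cmod (g z - f z) < \<delta>)
          \<Longrightarrow> finite {z \<in> U. g z = 0} \<and> zero_count g U = zero_count f U"
proof -
  define K where "K = closure U"
  have K: "compact K" "K \<subseteq> \<Omega>" "U \<subseteq> K" "frontier U \<subseteq> K"
    using U by (auto simp: K_def closure_subset frontier_def)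
  have "U \<noteq> UNIV"
    using U(2) not_bounded_UNIV by blast
  then obtain p where p: "p \<in> frontier U"
    using U(3) frontier_not_empty by blast
  define Z where "Z = {z \<in> U. f z = 0}"
  have "finite {z \<in> K. f z = 0}"
    using finite_zeros_in_compact[OF f \<Omega> K(1,2)] nz[OF p] p K by blast
  then have "finite Z"
    using K(3) by (auto simp: Z_def elim: rev_finite_subset)
  obtain r1 where "r1 > 0" and r1: "(\<Union>x\<in>Z. cball x r1) \<subseteq> U"
    using compact_subset_open_imp_cball_epsilon_subset[of Z U] \<open>finite Z\<close> U(1)
    by (auto simp: Z_def finite_imp_compact)
  have "uniform_discrete Z"
    using \<open>finite Z\<close> uniform_discrete_finite_iff by blast
  then obtain r2 where "r2 > 0" and r2: "\<And>x y. x \<in> Z \<Longrightarrow> y \<in> Z \<Longrightarrow> dist x y < r2 \<Longrightarrow> x = y"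
    unfolding uniform_discrete_def by blast
  \<comment> \<open>at most half the separation of the zeros, so that no closed disc meets another open disc\<close>
  define r where "r = min r1 (r2 / 2)"
  have "r > 0"
    using \<open>r1 > 0\<close> \<open>r2 > 0\<close> by (simp add: r_def)
  have disj: "x = y" if "x \<in> Z" "y \<in> Z" "z \<in> cball x r" "z \<in> ball y r" for x y z
  proof (rule r2)
    have "dist x y \<le> dist x z + dist z y"
      by (rule dist_triangle)
    also have "\<dots> < r2"
      using that(3,4) by (auto simp: r_def dist_commute)
    finally show "dist x y < r2" .
  qed (use that in auto)
  have sub: "cball x r \<subseteq> U" if "x \<in> Z" for x
    using r1 that by (force simp: r_def)
  define L where "L = K - (\<Union>x\<in>Z. ball x r)"
  have "compact L"
    unfolding L_def using K(1) by (intro compact_diff) auto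
  have "p \<in> L"
    using p K sub U(1) by (force simp: L_def frontier_def interior_open)
  have nzL: "f z \<noteq> 0" if "z \<in> L" for z
  proof
    assume "f z = 0"
    then have "z \<in> U"
      using that nz[of z] U(1) by (auto simp: L_def K_def frontier_def interior_open)
    then have "z \<in> Z"
      using \<open>f z = 0\<close> by (simp add: Z_def)
    then show False
      using that \<open>r > 0\<close> by (auto simp: L_def)
  qed
  have "continuous_on L (\<lambda>z. cmod (f z))"
    using f K(2) by (intro continuous_on_norm holomorphic_on_imp_continuous_on
        holomorphic_on_subset[OF f]) (auto simp: L_def)
  then obtain m where m: "m \<in> L" "\<And>z. z \<in> L \<Longrightarrow> cmod (f m) \<le> cmod (f z)"
    using continuous_attains_inf[OF \<open>compact L\<close>] \<open>p \<in> L\<close> by blast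
  show thesis
  proof
    show "cmod (f m) > 0"
      using nzL[OF m(1)] by simp
  next
    fix g assume g: "g holomorphic_on \<Omega>"
      and close: "\<And>z. z \<in> closure U \<Longrightarrow> cmod (g z - f z) < cmod (f m)"
    have less: "cmod (g z - f z) < cmod (f z)" if "z \<in> L" for z
      using close[of z] m(2)[OF that] that by (simp add: L_def K_def)
    have "finite {z \<in> K. g z = 0}"
      using finite_zeros_in_compact[OF g \<Omega> K(1,2), of p] less[OF \<open>p \<in> L\<close>] p K by force
    then have fin: "finite {z \<in> U. g z = 0}"
      using K(3) by (auto elim: rev_finite_subset)
    have "zero_count g (ball x r) = zero_count f (ball x r)" if "x \<in> Z" for x
    proof (rule Rouche_disc[OF f g \<Omega> \<open>r > 0\<close>])
      show "cball x r \<subseteq> \<Omega>"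
        using sub[OF that] K by blast
      show "cmod (g z - f z) < cmod (f z)" if z: "z \<in> sphere x r" for z
      proof (rule less)
        have "z \<in> cball x r" using z by auto
        moreover have "z \<notin> ball y r" if "y \<in> Z" for y
          using disj[OF \<open>x \<in> Z\<close> that \<open>z \<in> cball x r\<close>] z by auto
        ultimately show "z \<in> L"
          using sub[OF \<open>x \<in> Z\<close>] K(3) by (auto simp: L_def)
      qed
    qed
    moreover have "zero_count h U = (\<Sum>x\<in>Z. zero_count h (ball x r))"
      if fin: "finite {z \<in> U. h z = 0}" and h: "\<And>z. z \<in> L \<Longrightarrow> h z \<noteq> 0" for h
    proof -
      have "{z \<in> U. h z = 0} = (\<Union>x\<in>Z. {z \<in> ball x r. h z = 0})"
      proof safe
        fix z assume z: "z \<in> U" "h z = 0"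
        then show "z \<in> (\<Union>x\<in>Z. {z \<in> ball x r. h z = 0})"
          using h[of z] K(3) by (auto simp: L_def)
      next
        fix z x assume "x \<in> Z" "z \<in> ball x r"
        then show "z \<in> U"
          using sub by force
      qed
      moreover have "finite {z \<in> ball x r. h z = 0}" if "x \<in> Z" for x
        using sub[OF that] ball_subset_cball[of x r] by (intro finite_subset[OF _ fin]) blast
      moreover have "{z \<in> ball x r. h z = 0} \<inter> {z \<in> ball y r. h z = 0} = {}"
        if "x \<in> Z" "y \<in> Z" "x \<noteq> y" for x y
        using disj[OF that(1,2)] that(3) ball_subset_cball[of x r] by blast
      ultimately show ?thesis
        unfolding zero_count_def using \<open>finite Z\<close> by (simp add: sum.UNION_disjoint)
    qed
    moreover have "g z \<noteq> 0" if "z \<in> L" for z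
      using less[OF that] by auto
    ultimately have "zero_count g U = zero_count f U"
      using fin \<open>finite Z\<close> nzL by (simp add: Z_def)
    with fin show "finite {z \<in> U. g z = 0} \<and> zero_count g U = zero_count f U"
      by blast
  qed
qed

text \<open>
  By uniform continuity on the compact product, nearby parameters give uniformly close functions,
  so the count is locally constant on a connected interval.
\<close>

lemma zero_count_homotopy:
  fixes h :: "real \<Rightarrow> complex \<Rightarrow> complex"
  assumes h: "\<And>t. t \<in> {0..1} \<Longrightarrow> h t holomorphic_on \<Omega>" and \<Omega>: "open \<Omega>" "connected \<Omega>"
    and U: "open U" "bounded U" "U \<noteq> {}" "closure U \<subseteq> \<Omega>"
    and cont: "continuous_on ({0..1} \<times> closure U) (\<lambda>(t, z). h t z)"
    and nz: "\<And>t z. t \<in> {0..1} \<Longrightarrow> z \<in> frontier U \<Longrightarrow> h t z \<noteq> 0"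
  shows "finite {z \<in> U. h 0 z = 0}" "finite {z \<in> U. h 1 z = 0}"
    and "zero_count (h 0) U = zero_count (h 1) U"
proof -
  have fin: "finite {z \<in> U. h t z = 0}" if t: "t \<in> {0..1}" for t
  proof -
    \<comment> \<open>stability, applied to \<open>h t\<close> as a perturbation of itself\<close>
    obtain \<delta> where "\<delta> > 0" and \<delta>: "\<And>g. g holomorphic_on \<Omega> \<Longrightarrow>
        (\<And>z. z \<in> closure U \<Longrightarrow> cmod (g z - h t z) < \<delta>)
          \<Longrightarrow> finite {z \<in> U. g z = 0} \<and> zero_count g U = zero_count (h t) U"
      using zero_count_stable[OF h[OF t] \<Omega> U nz[OF t]] by blast
    show ?thesis
      using \<delta>[OF h[OF t]] \<open>\<delta> > 0\<close> by simp
  qed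
  then show "finite {z \<in> U. h 0 z = 0}" "finite {z \<in> U. h 1 z = 0}"
    by auto
  have unif: "uniformly_continuous_on ({0..1} \<times> closure U) (\<lambda>(t, z). h t z)"
    using cont U(2) by (intro compact_uniformly_continuous compact_Times) auto
  have "(\<lambda>t. zero_count (h t) U) constant_on {0..1}"
  proof (rule locally_constant_imp_constant)
    fix t :: real assume t: "t \<in> {0..1}"
    obtain \<delta> where "\<delta> > 0" and \<delta>: "\<And>g. g holomorphic_on \<Omega> \<Longrightarrow>
        (\<And>z. z \<in> closure U \<Longrightarrow> cmod (g z - h t z) < \<delta>)
          \<Longrightarrow> finite {z \<in> U. g z = 0} \<and> zero_count g U = zero_count (h t) U"
      using zero_count_stable[OF h[OF t] \<Omega> U nz[OF t]] by blast
    obtain d where "d > 0" and d: "\<And>x y. x \<in> {0..1} \<times> closure U \<Longrightarrow> y \<in> {0..1} \<times> closure U \<Longrightarrow>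
        dist y x < d \<Longrightarrow> dist (case y of (t, z) \<Rightarrow> h t z) (case x of (t, z) \<Rightarrow> h t z) < \<delta>"
      using unif \<open>\<delta> > 0\<close> unfolding uniformly_continuous_on_def by metis
    have "zero_count (h s) U = zero_count (h t) U" if "s \<in> {0..1} \<inter> ball t d" for s
    proof -
      have "cmod (h s z - h t z) < \<delta>" if "z \<in> closure U" for z
        using d[of "(t, z)" "(s, z)"] that t \<open>s \<in> {0..1} \<inter> ball t d\<close>
        by (simp add: dist_Pair_Pair dist_commute) (simp add: dist_norm norm_minus_commute)
      then show ?thesis
        using \<delta>[OF h] that by auto
    qed
    moreover have "openin (top_of_set {0..1}) ({0..1} \<inter> ball t d)" "t \<in> {0..1} \<inter> ball t d"
      using t \<open>d > 0\<close> by (auto intro: openin_open_Int)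
    ultimately show "\<exists>V. openin (top_of_set {0..1}) V \<and> t \<in> V \<and>
        (\<forall>s\<in>V. zero_count (h s) U = zero_count (h t) U)"
      by blast
  qed simp
  then show "zero_count (h 0) U = zero_count (h 1) U"
    unfolding constant_on_def by (metis atLeastAtMost_iff order_refl zero_le_one)
qed

section \<open>Counting eigenvalues\<close>

lemma holomorphic_on_det:
  fixes F :: "complex \<Rightarrow> complex^'n^'n"
  assumes "\<And>i j. (\<lambda>z. F z $ i $ j) holomorphic_on \<Omega>"
  shows "(\<lambda>z. det (F z)) holomorphic_on \<Omega>"
  unfolding det_def by (intro holomorphic_intros assms)

lemma eig_count_eq_zero_count:
  assumes "U \<subseteq> \<Omega>"
  shows "eigenvalues \<Omega> F \<inter> U = {z \<in> U. det (F z) = 0}"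
    and "eig_count \<Omega> F U = zero_count (\<lambda>z. det (F z)) U"
proof -
  show *: "eigenvalues \<Omega> F \<inter> U = {z \<in> U. det (F z) = 0}"
    using assms by (auto simp: eigenvalues_def invertible_det_nz)
  show "eig_count \<Omega> F U = zero_count (\<lambda>z. det (F z)) U"
    by (simp add: eig_count_def * zero_count_def eig_multiplicity_def)
qed

theorem theorem4p4:
  fixes \<Omega> \<Omega>\<^sub>\<epsilon> :: "complex set"
    and T E :: "complex \<Rightarrow> complex^'n^'n"
    and N :: "complex^'n \<Rightarrow> real"
    and \<epsilon> :: real
  assumes "vec_norm N"
    and "open \<Omega>" "connected \<Omega>" "\<Omega> \<noteq> {}" "simply_connected \<Omega>"
    and "mat_analytic_on T \<Omega>" "mat_analytic_on E \<Omega>"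
    and "regular_on T \<Omega>"
    and "\<epsilon> > 0"
    and "\<Omega>\<^sub>\<epsilon> = {z \<in> \<Omega>. induced_norm N (E z) < \<epsilon>}"
  shows "eigenvalues \<Omega> (\<lambda>z. T z + E z) \<inter> \<Omega>\<^sub>\<epsilon> \<subseteq> pseudospectrum N \<Omega> \<epsilon> T \<inter> \<Omega>\<^sub>\<epsilon> \<and>
    (\<forall>U. U \<in> components (pseudospectrum N \<Omega> \<epsilon> T) \<and> bounded U \<and> closure U \<subseteq> \<Omega>\<^sub>\<epsilon> \<longrightarrow>
      finite (eigenvalues \<Omega> T \<inter> U) \<and>
      finite (eigenvalues \<Omega> (\<lambda>z. T z + E z) \<inter> U) \<and>
      eig_count \<Omega> T U = eig_count \<Omega> (\<lambda>z. T z + E z) U)"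
proof (intro conjI allI impI; (elim conjE)?)
  let ?P = "pseudospectrum N \<Omega> \<epsilon> T"
  note N = assms(1) and \<Omega> = assms(2,3) and T = assms(6) and E = assms(7)
    and \<epsilon> = assms(9) and \<Omega>\<^sub>\<epsilon> = assms(10)
  have invertible: "invertible (T z + t *\<^sub>R E z)"
    if "z \<in> \<Omega>\<^sub>\<epsilon>" "z \<notin> ?P" "t \<in> {0..1}" for z t
    using that by (intro perturbation_invertible[OF N \<epsilon>]) (auto simp: \<Omega>\<^sub>\<epsilon> pseudospectrum_def not_less)
  show "eigenvalues \<Omega> (\<lambda>z. T z + E z) \<inter> \<Omega>\<^sub>\<epsilon> \<subseteq> ?P \<inter> \<Omega>\<^sub>\<epsilon>"
    using invertible[of _ 1] by (auto simp: eigenvalues_def)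
  fix U assume U: "U \<in> components ?P" "bounded U" "closure U \<subseteq> \<Omega>\<^sub>\<epsilon>"
  \<comment> \<open>the homotopy from \<open>det T\<close> to \<open>det (T + E)\<close>\<close>
  define h where "h t z = det (T z + t *\<^sub>R E z)" for t z
  have "open ?P"
    by (rule open_pseudospectrum[OF N \<epsilon> \<Omega>(1) T])
  then have "open U"
    using U(1) open_components by blast
  have "U \<noteq> {}"
    using U(1) in_components_nonempty by blast
  have "closure U \<subseteq> \<Omega>" "U \<subseteq> \<Omega>"
    using U(3) closure_subset[of U] by (auto simp: \<Omega>\<^sub>\<epsilon>)
  \<comment> \<open>The frontier of \<open>U\<close> lies outside the open pseudospectrum, but still where \<open>\<parallel>E\<parallel> < \<epsilon>\<close>.\<close>
  have nonzero: "h t z \<noteq> 0" if "t \<in> {0..1}" "z \<in> frontier U" for t z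
  proof -
    have "z \<in> frontier ?P"
      using frontier_of_components_subset[OF U(1)] that(2) by blast
    then have "z \<notin> ?P"
      using \<open>open ?P\<close> by (simp add: frontier_def interior_open)
    moreover have "z \<in> \<Omega>\<^sub>\<epsilon>"
      using that(2) U(3) by (auto simp: frontier_def)
    ultimately show ?thesis
      using invertible[of z t] that(1) by (simp add: h_def invertible_det_nz)
  qed
  have holo: "h t holomorphic_on \<Omega>" for t
    unfolding h_def
  proof (rule holomorphic_on_det)
    fix i j
    have "(\<lambda>z. T z $ i $ j) holomorphic_on \<Omega>" "(\<lambda>z. E z $ i $ j) holomorphic_on \<Omega>"
      using T E by (auto simp: mat_analytic_on_def intro: analytic_imp_holomorphic)
    then show "(\<lambda>z. (T z + t *\<^sub>R E z) $ i $ j) holomorphic_on \<Omega>"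
      by (simp add: scaleR_conv_of_real) (intro holomorphic_intros)
  qed
  have cont: "continuous_on ({0..1} \<times> closure U) (\<lambda>(t, z). h t z)"
  proof -
    have "continuous_on ({0..1 :: real} \<times> closure U) (\<lambda>x. F (snd x))"
      if "mat_analytic_on F \<Omega>" for F :: "complex \<Rightarrow> complex^'n^'n"
      using \<open>closure U \<subseteq> \<Omega>\<close>
      by (intro continuous_on_compose2[OF mat_analytic_on_imp_continuous_on[OF that]]
          continuous_intros) auto
    from this[OF T] this[OF E] show ?thesis
      unfolding h_def det_def case_prod_beta by (intro continuous_intros)
  qed
  note homotopy = zero_count_homotopy[OF holo \<Omega> \<open>open U\<close> U(2) \<open>U \<noteq> {}\<close> \<open>closure U \<subseteq> \<Omega>\<close>
      cont nonzero]
  show "finite (eigenvalues \<Omega> T \<inter> U)"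
    "finite (eigenvalues \<Omega> (\<lambda>z. T z + E z) \<inter> U)"
    "eig_count \<Omega> T U = eig_count \<Omega> (\<lambda>z. T z + E z) U"
    using homotopy by (simp_all add: eig_count_eq_zero_count[OF \<open>U \<subseteq> \<Omega>\<close>] h_def)
qed

end
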